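(* Let $H$ be a hypergraph that contains at least one edge, let $\mathcal{G}$ be the class of all hypergraphs, and let $f:\mathcal{G}\to\mathbb{N}$ be one of the functions $G\mapsto\#\mathrm{TrimHom}(H,G)$, $G\mapsto\#\mathrm{TrimSub}(H,G)$, $G\mapsto\#\mathrm{IndTrimSub}(H,G)$. Then there is no finitely supported function $\gamma$ from hypergraphs to $\mathbb{Q}$ such that $f(G)=\sum_{F\in\mathcal{G}}\gamma(F)\cdot\#\mathrm{Hom}(F,G)$ holds for all $G\in\mathcal{G}$.
   Context: A hypergraph is a pair $H=(V,E)$ with $V$ finite and $E\subseteq2^V\setminus\{\varnothing\}$; sums over $\mathcal{G}$ range over isomorphism types. A homomorphism from $F$ to $G$ is a map $\varphi:V(F)\to V(G)$ with $\varphi(e)\in E(G)$ for all $e\in E(F)$; $\mathrm{Hom}(F,G)$ is the set of these. A trimmed homomorphism is a map $\varphi:V(H)\to V(G)$ such that for every $e\in E(H)$ there is $e'\in E(G)$ with $\varphi(e)=e'\cap\mathrm{img}(\varphi)$; $\mathrm{TrimHom}(H,G)$ is their set. A trimmed sub-hypergraph of $G$ is a hypergraph $G'$ with $V(G')\subseteq V(G)$ such that every $e'\in E(G')$ equals $e\cap V(G')$ for some $e\in E(G)$; $\mathrm{TrimSub}(H,G)$ is the set of trimmed sub-hypergraphs of $G$ isomorphic to $H$. For $X\subseteq V(G)$, $G|_X:=(X,\{e\cap X:e\in E(G),e\cap X\ne\varnothing\})$; $\mathrm{IndTrimSub}(H,G)$ is the set of such induced trimmed sub-hypergraphs of $G$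 isomorphic to $H$. *)

theory Defs
  imports Complex_Main "HOL-Library.FuncSet" "HOL-Library.Infinite_Typeclass"
begin

text \<open>Over a vertex type \<open>'v\<close> with infinitely many elements (class \<open>infinite\<close>), every hypergraph has
  an isomorphic copy, so such a type represents the class of all hypergraphs up to isomorphism.\<close>

type_synonym 'v hypergraph = "'v set \<times> 'v set set"

abbreviation verts :: "'v hypergraph \<Rightarrow> 'v set" where
  "verts G \<equiv> fst G"

abbreviation edges :: "'v hypergraph \<Rightarrow> 'v set set" where
  "edges G \<equiv> snd G"

definition hypergraph :: "'v hypergraph \<Rightarrow> bool" where
  "hypergraph G \<longleftrightarrow> finite (verts G) \<and> edges G \<subseteq> Pow (verts G) - {{}}"

text \<open>Maps with domain \<open>V\<close> are extensional functions, so that each map is counted once.\<close>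

definition Hom :: "'v hypergraph \<Rightarrow> 'w hypergraph \<Rightarrow> ('v \<Rightarrow> 'w) set" where
  "Hom F G = {\<phi> \<in> verts F \<rightarrow>\<^sub>E verts G. \<forall>e\<in>edges F. \<phi> ` e \<in> edges G}"

definition TrimHom :: "'v hypergraph \<Rightarrow> 'w hypergraph \<Rightarrow> ('v \<Rightarrow> 'w) set" where
  "TrimHom H G =
     {\<phi> \<in> verts H \<rightarrow>\<^sub>E verts G. \<forall>e\<in>edges H. \<exists>e'\<in>edges G. \<phi> ` e = e' \<inter> \<phi> ` verts H}"

definition isomorphic :: "'v hypergraph \<Rightarrow> 'w hypergraph \<Rightarrow> bool" where
  "isomorphic F G \<longleftrightarrow>
     (\<exists>\<phi>. bij_betw \<phi> (verts F) (verts G) \<and>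
        (\<forall>e. e \<subseteq> verts F \<longrightarrow> (e \<in> edges F \<longleftrightarrow> \<phi> ` e \<in> edges G)))"

definition trimmed_sub :: "'v hypergraph \<Rightarrow> 'v hypergraph \<Rightarrow> bool" where
  "trimmed_sub G' G \<longleftrightarrow>
     hypergraph G' \<and> verts G' \<subseteq> verts G \<and> (\<forall>e'\<in>edges G'. \<exists>e\<in>edges G. e' = e \<inter> verts G')"

definition TrimSub :: "'v hypergraph \<Rightarrow> 'w hypergraph \<Rightarrow> 'w hypergraph set" where
  "TrimSub H G = {G'. trimmed_sub G' G \<and> isomorphic G' H}"

definition induced_trimmed_sub :: "'v hypergraph \<Rightarrow> 'v set \<Rightarrow> 'v hypergraph" where
  "induced_trimmed_sub G X = (X, {e \<inter> X | e. e \<in> edges G \<and> e \<inter> X \<noteq> {}})"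

definition IndTrimSub :: "'v hypergraph \<Rightarrow> 'w hypergraph \<Rightarrow> 'w hypergraph set" where
  "IndTrimSub H G =
     {G'. (\<exists>X \<subseteq> verts G. G' = induced_trimmed_sub G X) \<and> isomorphic G' H}"

definition iso_rel :: "('v hypergraph \<times> 'v hypergraph) set" where
  "iso_rel = {(F, G). hypergraph F \<and> hypergraph G \<and> isomorphic F G}"

definition iso_types :: "'v hypergraph set set" where
  "iso_types = {G. hypergraph G} // iso_rel"

text \<open>The number of homomorphisms from any representative of the isomorphism type \<open>\<tau>\<close>;
  \<open>hom_count_class\<close> below shows independence of the representative.\<close>

definition hom_count :: "'v hypergraph set \<Rightarrow> 'w hypergraph \<Rightarrow> nat" where
  "hom_count \<tau> G = the_elem ((\<lambda>F. card (Hom F G)) ` \<tau>)"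

lemma isomorphic_refl: "isomorphic F F"
  unfolding isomorphic_def by (rule exI[of _ id]) auto

lemma isomorphic_sym:
  assumes "isomorphic F G"
  shows "isomorphic G F"
proof -
  obtain \<phi> where b: "bij_betw \<phi> (verts F) (verts G)"
    and e: "\<And>e. e \<subseteq> verts F \<Longrightarrow> e \<in> edges F \<longleftrightarrow> \<phi> ` e \<in> edges G"
    using assms unfolding isomorphic_def by blast
  let ?\<psi> = "inv_into (verts F) \<phi>"
  have b': "bij_betw ?\<psi> (verts G) (verts F)"
    using b by (rule bij_betw_inv_into)
  have "d \<in> edges G \<longleftrightarrow> ?\<psi> ` d \<in> edges F" if d: "d \<subseteq> verts G" for d
  proof -
    have "?\<psi> ` d \<subseteq> verts F"
      using b' d by (auto simp: bij_betw_def)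
    moreover have "\<phi> ` ?\<psi> ` d = d"
      using bij_betw_imp_surj_on[OF b] d by (rule image_inv_into_cancel)
    ultimately show ?thesis
      using e[of "?\<psi> ` d"] by simp
  qed
  then show ?thesis
    unfolding isomorphic_def using b' by blast
qed

lemma isomorphic_trans:
  assumes "isomorphic F G" "isomorphic G K"
  shows "isomorphic F K"
proof -
  obtain \<phi> where b: "bij_betw \<phi> (verts F) (verts G)"
    and e: "\<And>e. e \<subseteq> verts F \<Longrightarrow> e \<in> edges F \<longleftrightarrow> \<phi> ` e \<in> edges G"
    using assms(1) unfolding isomorphic_def by blast
  obtain \<psi> where b': "bij_betw \<psi> (verts G) (verts K)"
    and e': "\<And>e. e \<subseteq> verts G \<Longrightarrow> e \<in> edges G \<longleftrightarrow> \<psi> ` e \<in> edges K"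
    using assms(2) unfolding isomorphic_def by blast
  have "e \<in> edges F \<longleftrightarrow> (\<psi> \<circ> \<phi>) ` e \<in> edges K" if "e \<subseteq> verts F" for e
  proof -
    have "\<phi> ` e \<subseteq> verts G"
      using b that by (auto simp: bij_betw_def)
    then show ?thesis
      using e[OF that] e' by (simp add: image_comp)
  qed
  then show ?thesis
    unfolding isomorphic_def using bij_betw_trans[OF b b'] by blast
qed

lemma equiv_iso_rel: "equiv {G. hypergraph G} iso_rel"
  by (rule equivI)
    (auto simp: iso_rel_def refl_on_def sym_def trans_def
      intro: isomorphic_refl isomorphic_sym isomorphic_trans)

lemma finite_Hom: "finite (verts F) \<Longrightarrow> finite (verts G) \<Longrightarrow> finite (Hom F G)"
  unfolding Hom_def by (rule finite_subset[of _ "verts F \<rightarrow>\<^sub>E verts G"]) (auto intro: finite_PiE)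

lemma card_Hom_le:
  fixes F :: "'a hypergraph" and F' :: "'b hypergraph" and G :: "'c hypergraph"
  assumes "isomorphic F F'" "hypergraph F" "hypergraph F'" "hypergraph G"
  shows "card (Hom F' G) \<le> card (Hom F G)"
proof -
  obtain \<phi> where b: "bij_betw \<phi> (verts F) (verts F')"
    and e: "\<And>e. e \<subseteq> verts F \<Longrightarrow> e \<in> edges F \<longleftrightarrow> \<phi> ` e \<in> edges F'"
    using assms(1) unfolding isomorphic_def by blast
  define r where "r h = restrict (h \<circ> \<phi>) (verts F)" for h :: "'b \<Rightarrow> 'c"
  have r: "r h x = h (\<phi> x)" if "x \<in> verts F" for h x
    using that by (simp add: r_def)
  have inj: "inj_on r (Hom F' G)"
  proof (rule inj_onI)
    fix g h assume g: "g \<in> Hom F' G" and h: "h \<in> Hom F' G" and eq: "r g = r h"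
    have gh: "g y = h y" if y: "y \<in> verts F'" for y
    proof -
      have "y \<in> \<phi> ` verts F"
        using bij_betw_imp_surj_on[OF b] y by simp
      then obtain x where x: "x \<in> verts F" "y = \<phi> x"
        by (rule imageE)
      show ?thesis
        unfolding x(2) using r[OF x(1), of g] r[OF x(1), of h] eq by simp
    qed
    have "g \<in> verts F' \<rightarrow>\<^sub>E verts G" "h \<in> verts F' \<rightarrow>\<^sub>E verts G"
      using g h by (simp_all add: Hom_def)
    then show "g = h"
      using gh by (rule PiE_ext)
  qed
  have sub: "r ` Hom F' G \<subseteq> Hom F G"
  proof (rule image_subsetI)
    fix h assume h: "h \<in> Hom F' G"
    have "r h ` d \<in> edges G" if d: "d \<in> edges F" for d
    proof -
      have dV: "d \<subseteq> verts F"
        using d assms(2) unfolding hypergraph_def by auto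
      have "r h ` d = (\<lambda>x. h (\<phi> x)) ` d"
        by (rule image_cong) (use dV r in auto)
      then have "r h ` d = h ` \<phi> ` d"
        by (simp add: image_image)
      then show ?thesis
        using h e[OF dV] d by (simp add: Hom_def)
    qed
    moreover have "r h \<in> verts F \<rightarrow>\<^sub>E verts G"
    proof (rule PiE_I)
      fix x assume x: "x \<in> verts F"
      have "h \<in> verts F' \<rightarrow>\<^sub>E verts G"
        using h by (simp add: Hom_def)
      then show "r h x \<in> verts G"
        unfolding r[OF x] using bij_betw_apply[OF b x] by (rule PiE_mem)
    qed (simp add: r_def)
    ultimately show "r h \<in> Hom F G"
      by (simp add: Hom_def)
  qed
  have "finite (Hom F G)"
    using assms(2,4) by (simp add: hypergraph_def finite_Hom)
  with inj sub show ?thesis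
    by (rule card_inj_on_le)
qed

lemma hom_count_class:
  assumes "hypergraph F" "hypergraph G"
  shows "hom_count (iso_rel `` {F}) G = card (Hom F G)"
proof -
  have "card (Hom F' G) = card (Hom F G)" if "F' \<in> iso_rel `` {F}" for F'
  proof -
    have "hypergraph F'" "isomorphic F F'"
      using that unfolding iso_rel_def by auto
    then show ?thesis
      using card_Hom_le[of F F' G] card_Hom_le[of F' F G] isomorphic_sym[of F F'] assms
      by linarith
  qed
  moreover have "F \<in> iso_rel `` {F}"
    using assms(1) by (simp add: iso_rel_def isomorphic_refl)
  ultimately have "(\<lambda>F. card (Hom F G)) ` (iso_rel `` {F}) = {card (Hom F G)}"
    by blast
  then show ?thesis
    unfolding hom_count_def by simp
qed

end

theory Submission
  imports Defs
begin

text \<open>A homomorphic image of an edge is at most as large as the edge. Hence adding one large set \<open>N\<close> of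
  fresh vertices to every edge of \<open>H\<close> gives a hypergraph that no function with small support can
  distinguish from the edgeless hypergraph on the same vertices. All three functions \<open>f\<close> do
  distinguish them, because trimming away \<open>N\<close> gives \<open>H\<close> back.\<close>

text \<open>If \<open>F\<close> has no edge, membership depends only on \<open>verts G\<close>. If
  it has one, both sides are empty: the image of that edge has at most \<open>card (verts F)\<close>
  elements, too few for an edge of \<open>G\<close>.\<close>

lemma Hom_eq_Hom_edgeless:
  fixes F :: "'v hypergraph" and G :: "'w hypergraph"
  assumes "hypergraph F" and large: "\<And>e. e \<in> edges G \<Longrightarrow> card (verts F) < card e"
  shows "Hom F G = Hom F (verts G, {})"
proof (cases "edges F = {}")
  case True
  then show ?thesis
    by (simp add: Hom_def)
next
  case False
  then obtain d where d: "d \<in> edges F"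
    by blast
  have fin: "finite (verts F)" and "d \<subseteq> verts F"
    using assms(1) d by (auto simp: hypergraph_def)
  then have "card (\<phi> ` d) \<le> card (verts F)" for \<phi> :: "'v \<Rightarrow> 'w"
    by (meson card_image_le card_mono finite_subset le_trans)
  then have "\<phi> ` d \<notin> edges G" for \<phi> :: "'v \<Rightarrow> 'w"
    using large leD by blast
  then show ?thesis
    using d by (auto simp: Hom_def)
qed

text \<open>\<open>isomorphic\<close> compares only subsets of the vertex set;
  \<open>hypergraph F\<close> places the given edge there.\<close>

lemma isomorphic_edges_nonempty:
  assumes "isomorphic F G" "hypergraph F" "edges F \<noteq> {}"
  shows "edges G \<noteq> {}"
proof -
  obtain d where d: "d \<in> edges F"
    using assms(3) by blast
  then have "d \<subseteq> verts F"
    using assms(2) by (auto simp: hypergraph_def)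
  then show ?thesis
    using assms(1) d unfolding isomorphic_def by blast
qed

text \<open>Through this inclusion the induced case inherits both emptiness and finiteness from
  \<open>TrimSub\<close>.\<close>

lemma IndTrimSub_subset_TrimSub:
  assumes "hypergraph G"
  shows "IndTrimSub H G \<subseteq> TrimSub H G"
proof -
  have "trimmed_sub (induced_trimmed_sub G X) G" if "X \<subseteq> verts G" for X
    using assms that
    by (auto simp: trimmed_sub_def induced_trimmed_sub_def hypergraph_def dest: finite_subset)
  then show ?thesis
    by (auto simp: IndTrimSub_def TrimSub_def)
qed

lemma finite_TrimHom:
  "finite (verts H) \<Longrightarrow> finite (verts G) \<Longrightarrow> finite (TrimHom H G)"
  unfolding TrimHom_def by (rule finite_subset[of _ "verts H \<rightarrow>\<^sub>E verts G"]) (auto intro: finite_PiE)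

lemma finite_TrimSub:
  assumes "finite (verts G)"
  shows "finite (TrimSub H G)"
proof (rule finite_subset)
  show "TrimSub H G \<subseteq> Pow (verts G) \<times> Pow (Pow (verts G))"
    by (fastforce simp: TrimSub_def trimmed_sub_def hypergraph_def)
qed (simp add: assms)

lemma TrimHom_edgeless:
  "edges H \<noteq> {} \<Longrightarrow> TrimHom H (V, {}) = {}"
  by (auto simp: TrimHom_def)

text \<open>Every edge of a trimmed sub-hypergraph is the trace of an edge of the host, so here only
  edgeless ones occur, and none of these is isomorphic to \<open>H\<close>.\<close>

lemma TrimSub_edgeless:
  fixes H :: "'w hypergraph" and V :: "'v set"
  assumes "hypergraph H" "edges H \<noteq> {}"
  shows "TrimSub H (V, {}) = {}"
proof -
  have "\<not> isomorphic G' H" if "trimmed_sub G' (V, {})" for G' :: "'v hypergraph"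
    using that isomorphic_edges_nonempty[OF isomorphic_sym assms, of G']
    by (auto simp: trimmed_sub_def)
  then show ?thesis
    by (auto simp: TrimSub_def)
qed

text \<open>Meant for \<open>N\<close> disjoint from \<open>verts H\<close>, so that intersecting
  with \<open>verts H\<close> undoes the enlargement.\<close>

definition enlarge_edges :: "'v hypergraph \<Rightarrow> 'v set \<Rightarrow> 'v hypergraph" where
  "enlarge_edges H N = (verts H \<union> N, (\<lambda>e. e \<union> N) ` edges H)"

lemma hypergraph_enlarge_edges:
  "hypergraph H \<Longrightarrow> finite N \<Longrightarrow> hypergraph (enlarge_edges H N)"
  by (auto simp: enlarge_edges_def hypergraph_def)

lemma enlarged_edge_Int_verts:
  assumes "hypergraph H" "N \<inter> verts H = {}" "e \<in> edges H"
  shows "(e \<union> N) \<inter> verts H = e"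
  using assms by (auto simp: hypergraph_def)

lemma induced_trimmed_sub_enlarge_edges:
  assumes "hypergraph H" "N \<inter> verts H = {}"
  shows "induced_trimmed_sub (enlarge_edges H N) (verts H) = H"
proof -
  have "{e \<inter> verts H | e. e \<in> (\<lambda>e. e \<union> N) ` edges H \<and> e \<inter> verts H \<noteq> {}} = edges H" (is "?L = _")
  proof
    show "?L \<subseteq> edges H"
      using enlarged_edge_Int_verts[OF assms] by auto
    show "edges H \<subseteq> ?L"
    proof
      fix e assume e: "e \<in> edges H"
      \<comment> \<open>Empty traces are discarded by \<open>induced_trimmed_sub\<close>; no edge of
        \<open>H\<close> is lost, since hypergraph edges are nonempty.\<close>
      then have "e \<noteq> {}"
        using assms(1) by (auto simp: hypergraph_def)
      then show "e \<in> ?L"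
        using e enlarged_edge_Int_verts[OF assms e]
        by (intro CollectI exI[of _ "e \<union> N"]) (simp add: imageI)
    qed
  qed
  then show ?thesis
    by (simp add: induced_trimmed_sub_def enlarge_edges_def prod_eq_iff)
qed

lemma mem_IndTrimSub_enlarge_edges:
  assumes "hypergraph H" "N \<inter> verts H = {}"
  shows "H \<in> IndTrimSub H (enlarge_edges H N)"
proof -
  have "verts H \<subseteq> verts (enlarge_edges H N)"
    by (simp add: enlarge_edges_def)
  then show ?thesis
    unfolding IndTrimSub_def
    by (intro CollectI conjI exI[of _ "verts H"] isomorphic_refl)
      (simp_all add: induced_trimmed_sub_enlarge_edges[OF assms])
qed

text \<open>The inclusion map has image \<open>verts H\<close>, so \<open>e \<union> N\<close>
  serves as the edge whose trace is \<open>e\<close>. Restricting \<open>id\<close> makes the map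
  extensional.\<close>

lemma mem_TrimHom_enlarge_edges:
  assumes "hypergraph H" "N \<inter> verts H = {}"
  shows "restrict id (verts H) \<in> TrimHom H (enlarge_edges H N)"
proof -
  have "restrict id (verts H) ` e = (e \<union> N) \<inter> restrict id (verts H) ` verts H"
    if e: "e \<in> edges H" for e
  proof -
    have "e \<subseteq> verts H"
      using assms(1) e by (auto simp: hypergraph_def)
    then have "restrict id (verts H) ` e = e"
      by force
    then show ?thesis
      using enlarged_edge_Int_verts[OF assms e] by simp
  qed
  then show ?thesis
    by (auto simp: TrimHom_def enlarge_edges_def)
qed

theorem theorem6p3:
  fixes H :: "'v::infinite hypergraph"
    and f :: "'v hypergraph \<Rightarrow> nat"
  assumes "hypergraph H"
    and "edges H \<noteq> {}"
    and "f = (\<lambda>G. card (TrimHom H G)) \<or>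
         f = (\<lambda>G. card (TrimSub H G)) \<or>
         f = (\<lambda>G. card (IndTrimSub H G))"
  shows "\<not> (\<exists>\<gamma> :: 'v hypergraph set \<Rightarrow> rat.
           finite {\<tau> \<in> iso_types. \<gamma> \<tau> \<noteq> 0} \<and>
           (\<forall>G :: 'v hypergraph. hypergraph G \<longrightarrow>
              rat_of_nat (f G) =
                (\<Sum>\<tau> \<in> {\<tau> \<in> iso_types. \<gamma> \<tau> \<noteq> 0}. \<gamma> \<tau> * rat_of_nat (hom_count \<tau> G))))"
proof
  assume "\<exists>\<gamma> :: 'v hypergraph set \<Rightarrow> rat.
           finite {\<tau> \<in> iso_types. \<gamma> \<tau> \<noteq> 0} \<and>
           (\<forall>G :: 'v hypergraph. hypergraph G \<longrightarrow>
              rat_of_nat (f G) =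
                (\<Sum>\<tau> \<in> {\<tau> \<in> iso_types. \<gamma> \<tau> \<noteq> 0}. \<gamma> \<tau> * rat_of_nat (hom_count \<tau> G)))"
  then obtain \<gamma> :: "'v hypergraph set \<Rightarrow> rat" where
    fin: "finite {\<tau> \<in> iso_types. \<gamma> \<tau> \<noteq> 0}" and
    sum: "\<And>G. hypergraph G \<Longrightarrow> rat_of_nat (f G) =
            (\<Sum>\<tau> \<in> {\<tau> \<in> iso_types. \<gamma> \<tau> \<noteq> 0}. \<gamma> \<tau> * rat_of_nat (hom_count \<tau> G))"
    by blast
  define S where "S = {\<tau> \<in> iso_types. \<gamma> \<tau> \<noteq> 0}"
  \<comment> \<open>Representatives turn \<open>hom_count\<close> of a type into the size of an
    actual \<open>Hom\<close> set, by \<open>hom_count_class\<close>.\<close>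
  have "\<exists>F. hypergraph F \<and> \<tau> = iso_rel `` {F}" if "\<tau> \<in> S" for \<tau>
    using that by (auto simp: S_def iso_types_def quotient_def)
  then obtain rep where rep: "\<And>\<tau>. \<tau> \<in> S \<Longrightarrow> hypergraph (rep \<tau>)"
    and \<tau>_eq: "\<And>\<tau>. \<tau> \<in> S \<Longrightarrow> \<tau> = iso_rel `` {rep \<tau>}"
    by metis
  \<comment> \<open>The sum bounds the order of every representative, also when \<open>S\<close> is
    empty; \<open>Suc\<close> makes the bound strict.\<close>
  define m where "m = Suc (\<Sum>\<tau>\<in>S. card (verts (rep \<tau>)))"
  have finH: "finite (verts H)"
    using assms(1) by (simp add: hypergraph_def)
  \<comment> \<open>The infinite vertex type leaves room for \<open>m\<close> fresh
    vertices.\<close>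
  then have "infinite (UNIV - verts H)"
    by (simp add: infinite_UNIV Diff_infinite_finite)
  then obtain N where N: "finite N" "card N = m" "N \<subseteq> UNIV - verts H"
    using infinite_arbitrarily_large by blast
  then have disj: "N \<inter> verts H = {}"
    by blast
  define G where "G = enlarge_edges H N"
  define G' :: "'v hypergraph" where "G' = (verts G, {})"
  have G: "hypergraph G"
    unfolding G_def using assms(1) N(1) by (rule hypergraph_enlarge_edges)
  then have finG: "finite (verts G)" and G': "hypergraph G'"
    by (simp_all add: hypergraph_def G'_def)
  have "hom_count \<tau> G = hom_count \<tau> G'" if \<tau>: "\<tau> \<in> S" for \<tau>
  proof -
    have "card (verts (rep \<tau>)) < card e" if e: "e \<in> edges G" for e
    proof -
      have "card (verts (rep \<tau>)) < m"
        using member_le_sum[OF \<tau>, of "\<lambda>\<tau>. card (verts (rep \<tau>))"] fin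
        by (simp add: m_def S_def less_Suc_eq_le)
      moreover have "card N \<le> card e"
      proof (rule card_mono)
        show "finite e"
          using e G finG finite_subset by (auto simp: hypergraph_def)
        show "N \<subseteq> e"
          using e by (auto simp: G_def enlarge_edges_def)
      qed
      ultimately show ?thesis
        using N(2) by simp
    qed
    then have "Hom (rep \<tau>) G = Hom (rep \<tau>) G'"
      unfolding G'_def using rep[OF \<tau>] by (intro Hom_eq_Hom_edgeless)
    then show ?thesis
      using hom_count_class[OF rep[OF \<tau>]] G G' \<tau>_eq[OF \<tau>] by metis
  qed
  \<comment> \<open>The two expansions agree term by term.\<close>
  then have "rat_of_nat (f G) = rat_of_nat (f G')"
    unfolding sum[OF G] sum[OF G'] by (intro sum.cong) (auto simp: S_def)
  then have "f G = f G'"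
    by simp
  moreover have "f G' = 0"
  proof -
    have "TrimSub H G' = {}"
      unfolding G'_def using assms(1,2) by (rule TrimSub_edgeless)
    moreover from this have "IndTrimSub H G' = {}"
      using IndTrimSub_subset_TrimSub[OF G'] by blast
    moreover have "TrimHom H G' = {}"
      unfolding G'_def using assms(2) by (rule TrimHom_edgeless)
    ultimately show ?thesis
      using assms(3) by auto
  qed
  moreover have "f G \<noteq> 0"
  proof -
    have "H \<in> IndTrimSub H G"
      unfolding G_def using assms(1) disj by (rule mem_IndTrimSub_enlarge_edges)
    moreover note sub = IndTrimSub_subset_TrimSub[OF G, of H]
    moreover have "restrict id (verts H) \<in> TrimHom H G"
      unfolding G_def using assms(1) disj by (rule mem_TrimHom_enlarge_edges)
    \<comment> \<open>Finiteness is essential: \<open>card\<close> of an infinite set is 0, so a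
      member alone would not make the count nonzero.\<close>
    moreover note finite_TrimHom[OF finH finG]
      and finite_TrimSub[OF finG, of H]
      and finite_subset[OF sub finite_TrimSub[OF finG, of H]]
    ultimately show ?thesis
      using assms(3) by (auto simp: card_gt_0_iff)
  qed
  ultimately show False
    by simp
qed

end
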